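(* Let $\tau>0$ and let $\widehat\rho(t)$, $t\in[0,\tau]$, be the normalized density operator of the non-hermitian dynamics generated by $\mathcal{H}(t)=H(t)-i\Gamma(t)$ on a finite-dimensional complex Hilbert space, as described in the context. Assume $\int_0^\tau\Delta_\Gamma(t)\,dt\le\pi/2$, where $\Delta_\Gamma(t)$ is the standard deviation of $\Gamma(t)$ in the state $\widehat\rho(t)$, and assume that the time average $\overline{\Delta_\Gamma}:=\frac1\tau\int_0^\tau\Delta_\Gamma(t)\,dt$ is nonzero. Then $$\tau\ \ge\ \frac{\widetilde{\mathcal{L}}_D([\widehat\rho(0)],[\widehat\rho(\tau)])}{\overline{\Delta_\Gamma}}.$$
   Context: Dynamics (units $\hbar=1$): $H(t)$ and $\Gamma(t)$ are hermitian operators depending continuously on $t\in[0,\tau]$, $\mathcal{H}(t):=H(t)-i\Gamma(t)$, and $\rho(t)$ solves $\dot\rho(t)=-i\left(\mathcal{H}(t)\rho(t)-\rho(t)\mathcal{H}^\dagger(t)\right)$ with $\rho(0)$ a density operator. The normalized density operator is $\widehat\rho(t):=\rho(t)/\mathrm{Tr}[\rho(t)]$. For hermitian $X(t)$, $\langle X\rangle(t):=\mathrm{Tr}[X(t)\widehat\rho(t)]$, and $\Delta_\Gamma(t):=\sqrt{\langle\Gamma^2\rangle(t)-\langle\Gamma\rangle(t)^2}$. Distance: for density operators $\rho,\sigma$ on an $n$-dimensional space with eigenvalue vectors $\mathbf{p},\mathbf{q}$, $\widetilde{\mathcal{L}}_D([\rho],[\sigma]):=\min_{U\text{ unitary}}\mathcal{L}_D(U\rho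 U^\dagger,\sigma)=\arccos\left(\sum_{i=1}^n\sqrt{p_i^\uparrow q_i^\uparrow}\right)$, where $\uparrow$ denotes arrangement of components in non-descending order, $\mathcal{L}_D(\rho,\sigma):=\arccos\sqrt{\mathrm{Fid}(\rho,\sigma)}$ is the Bures angle, and $\mathrm{Fid}(\rho,\sigma):=\left(\mathrm{Tr}\sqrt{\sqrt\rho\,\sigma\sqrt\rho}\right)^2$; $[\rho]$ denotes the class of $\rho$ under unitary conjugation. *)

theory Defs
  imports "HOL-Analysis.Analysis"
begin

text \<open>Operators on an n-dimensional complex Hilbert space are represented by their matrices with
  respect to an orthonormal basis indexed by the finite type \<open>'n\<close>.\<close>

definition cscale :: "complex \<Rightarrow> complex^'n^'n \<Rightarrow> complex^'n^'n" where
  "cscale c A = (\<chi> i j. c * A $ i $ j)"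

definition dagger :: "complex^'n^'n \<Rightarrow> complex^'n^'n" where
  "dagger A = (\<chi> i j. cnj (A $ j $ i))"

definition hermitian :: "complex^'n^'n \<Rightarrow> bool" where
  "hermitian A \<longleftrightarrow> dagger A = A"

definition unitary :: "complex^'n^'n \<Rightarrow> bool" where
  "unitary U \<longleftrightarrow> dagger U ** U = mat 1 \<and> U ** dagger U = mat 1"

text \<open>The quadratic form of a hermitian matrix is real, so taking \<open>Re\<close> loses nothing.\<close>

definition positive_semidefinite :: "complex^'n^'n \<Rightarrow> bool" where
  "positive_semidefinite A \<longleftrightarrow>
     hermitian A \<and> (\<forall>v. 0 \<le> Re (\<Sum>i\<in>UNIV. cnj (v $ i) * (A *v v) $ i))"

definition density_operator :: "complex^'n^'n \<Rightarrow> bool" where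
  "density_operator \<rho> \<longleftrightarrow> positive_semidefinite \<rho> \<and> trace \<rho> = 1"

text \<open>Every positive semidefinite matrix has exactly one positive semidefinite square root;
  \<open>op_sqrt A\<close> is unspecified for all other matrices.\<close>

definition op_sqrt :: "complex^'n^'n \<Rightarrow> complex^'n^'n" where
  "op_sqrt A = (THE B. positive_semidefinite B \<and> B ** B = A)"

text \<open>Below, \<open>Re\<close> is only applied to traces that are real for density operators
  (and hermitian observables).\<close>

definition fidelity :: "complex^'n^'n \<Rightarrow> complex^'n^'n \<Rightarrow> real" where
  "fidelity \<rho> \<sigma> = (Re (trace (op_sqrt (op_sqrt \<rho> ** \<sigma> ** op_sqrt \<rho>))))\<^sup>2"

definition bures_angle :: "complex^'n^'n \<Rightarrow> complex^'n^'n \<Rightarrow> real" where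
  "bures_angle \<rho> \<sigma> = arccos (sqrt (fidelity \<rho> \<sigma>))"

text \<open>The minimum of the Bures angle over the unitary orbit of \<open>\<rho>\<close>. The unitary group is compact
  and the Bures angle is continuous on density operators, so the infimum is attained. The value
  depends only on the unitary conjugacy classes of \<open>\<rho>\<close> and \<open>\<sigma>\<close>, which are given by
  representatives.\<close>

definition bures_class_dist :: "complex^'n^'n \<Rightarrow> complex^'n^'n \<Rightarrow> real" where
  "bures_class_dist \<rho> \<sigma> = (INF U\<in>{U. unitary U}. bures_angle (U ** \<rho> ** dagger U) \<sigma>)"

definition nh_generator :: "complex^'n^'n \<Rightarrow> complex^'n^'n \<Rightarrow> complex^'n^'n" where
  "nh_generator H \<Gamma> = H - cscale \<i> \<Gamma>"

definition normalized :: "complex^'n^'n \<Rightarrow> complex^'n^'n" where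
  "normalized \<rho> = cscale (1 / trace \<rho>) \<rho>"

definition expectation :: "complex^'n^'n \<Rightarrow> complex^'n^'n \<Rightarrow> real" where
  "expectation X \<rho> = Re (trace (X ** \<rho>))"

definition std_deviation :: "complex^'n^'n \<Rightarrow> complex^'n^'n \<Rightarrow> real" where
  "std_deviation X \<rho> = sqrt (expectation (X ** X) \<rho> - (expectation X \<rho>)\<^sup>2)"

definition time_average :: "real \<Rightarrow> (real \<Rightarrow> real) \<Rightarrow> real" where
  "time_average \<tau> f = (1 / \<tau>) * integral {0..\<tau>} f"

end

theory Submission
  imports Defs
begin

text \<open>Write \<open>\<rho>(t) = K(t) \<rho>(0) K(t)\<^sup>\<dagger>\<close> with the propagator \<open>K\<close> of \<open>\<H>\<close>, let \<open>W\<close> be the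
  propagator of the hermitian part \<open>H\<close>, and let \<open>S = \<surd>\<rho>(0)\<close>. In the interaction picture
  \<open>Q = W\<^sup>\<dagger> K S\<close> satisfies \<open>Q' = - W\<^sup>\<dagger> \<Gamma> W Q\<close>, so \<open>Q / \<parallel>Q\<parallel>\<close> moves on the Hilbert-Schmidt unit
  sphere with speed exactly \<open>\<Delta>\<^sub>\<Gamma>\<close>. Hence the angle between its end points is at most
  \<open>\<integral>\<Delta>\<^sub>\<Gamma>\<close>. These end points purify the initial state and the final state conjugated by
  \<open>W(\<tau>)\<^sup>\<dagger>\<close>, and the fidelity dominates the overlap of purifications, so the unitary
  \<open>U = W(\<tau>)\<close> already realizes the bound in the minimum defining the distance.\<close>

section \<open>Complex matrices and the spectral theorem\<close>

lemma dagger_nth [simp]: "dagger A $ i $ j = cnj (A $ j $ i)"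
  by (simp add: dagger_def)

lemma dagger_dagger [simp]: "dagger (dagger A) = A"
  by (simp add: vec_eq_iff)

lemma dagger_mat_1 [simp]: "dagger (mat 1) = mat 1"
  by (simp add: vec_eq_iff mat_def)

lemma dagger_diff: "dagger (A - B) = dagger A - dagger B"
  by (simp add: vec_eq_iff)

lemma dagger_scaleR: "dagger (r *\<^sub>R A) = r *\<^sub>R dagger A"
  by (simp add: vec_eq_iff)

lemma dagger_uminus: "dagger (- A) = - dagger A"
  by (simp add: vec_eq_iff)

lemma dagger_mult: "dagger (A ** B) = dagger B ** dagger A"
  by (simp add: vec_eq_iff matrix_matrix_mult_def mult.commute)

lemma bounded_linear_dagger: "bounded_linear dagger"
  unfolding linear_conv_bounded_linear[symmetric]
  by (intro linearI) (simp_all add: vec_eq_iff)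

text \<open>Real bilinearity supplies the distributive laws, continuity and the product rule for
  \<open>**\<close>, and makes matrix equations an instance of the linear differential equations
  solved below.\<close>

lemma bounded_bilinear_matrix_mult:
  "bounded_bilinear ((**) :: complex^'n^'n \<Rightarrow> complex^'n^'n \<Rightarrow> complex^'n^'n)"
  unfolding bilinear_conv_bounded_bilinear[symmetric] bilinear_def
  by (auto intro!: linearI
      simp: vec_eq_iff matrix_matrix_mult_def sum.distrib algebra_simps scaleR_sum_right)

lemmas matrix_scaleR_left = bounded_bilinear.scaleR_left[OF bounded_bilinear_matrix_mult]
  and matrix_scaleR_right = bounded_bilinear.scaleR_right[OF bounded_bilinear_matrix_mult]
  and matrix_diff_left = bounded_bilinear.diff_left[OF bounded_bilinear_matrix_mult]
  and matrix_diff_right = bounded_bilinear.diff_right[OF bounded_bilinear_matrix_mult]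
  and matrix_add_left = bounded_bilinear.add_left[OF bounded_bilinear_matrix_mult]
  and matrix_add_right = bounded_bilinear.add_right[OF bounded_bilinear_matrix_mult]

text \<open>The Euclidean inner product of matrices, viewed as a real vector space, is the real part
  of the Hilbert-Schmidt product. Geometry of purifications thus becomes real geometry with
  \<open>\<bullet>\<close> and \<open>norm\<close>.\<close>

lemma inner_matrix_eq_trace: "A \<bullet> B = Re (trace (dagger A ** B))"
  for A B :: "complex^'n^'n"
proof -
  have "A \<bullet> B = (\<Sum>i\<in>UNIV. \<Sum>j\<in>UNIV. Re (cnj (A $ i $ j) * B $ i $ j))"
    by (simp add: inner_vec_def inner_complex_def)
  also have "\<dots> = (\<Sum>j\<in>UNIV. \<Sum>i\<in>UNIV. Re (cnj (A $ i $ j) * B $ i $ j))"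
    by (rule sum.swap)
  finally show ?thesis
    by (simp add: trace_def matrix_matrix_mult_def)
qed

lemma inner_matrix_adjoint_left: "(X ** A) \<bullet> B = A \<bullet> (dagger X ** B)"
  for A B :: "complex^'n^'n"
  by (simp add: inner_matrix_eq_trace dagger_mult matrix_mul_assoc)

lemma inner_matrix_adjoint_right: "(A ** X) \<bullet> B = A \<bullet> (B ** dagger X)"
  for A B :: "complex^'n^'n"
  using trace_mul_sym[of "dagger X" "dagger A ** B"]
  by (simp add: inner_matrix_eq_trace dagger_mult matrix_mul_assoc)

lemma Re_trace_mult_dagger: "Re (trace (A ** dagger B)) = B \<bullet> A"
  for A B :: "complex^'n^'n"
  by (simp add: inner_matrix_eq_trace trace_mul_sym[of A])

lemma trace_mult_dagger_self: "trace (A ** dagger A) = of_real ((norm A)\<^sup>2)"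
  for A :: "complex^'n^'n"
proof -
  have "Im (trace (A ** dagger A)) = 0"
    by (simp add: trace_def matrix_matrix_mult_def)
  then show ?thesis
    by (simp add: complex_eq_iff Re_trace_mult_dagger power2_norm_eq_inner)
qed

section \<open>Unitary matrices\<close>

lemma unitaryD:
  assumes "unitary U"
  shows "dagger U ** U = mat 1" "U ** dagger U = mat 1"
    "dagger U ** (U ** A) = A" "U ** (dagger U ** A) = A"
    "A ** dagger U ** U = A" "A ** U ** dagger U = A"
  using assms unfolding unitary_def
  by (simp_all add: matrix_mul_assoc) (simp_all add: matrix_mul_assoc[symmetric])

lemma unitary_dagger: "unitary U \<Longrightarrow> unitary (dagger U)"
  by (simp add: unitary_def)

lemma norm_unitary_mult: "norm (U ** A) = norm A" if "unitary U" for A U :: "complex^'n^'n"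
  using that by (simp add: norm_eq_sqrt_inner inner_matrix_adjoint_left unitaryD)

lemma norm_mult_unitary: "norm (A ** U) = norm A" if "unitary U" for A U :: "complex^'n^'n"
  using that by (simp add: norm_eq_sqrt_inner inner_matrix_adjoint_right unitaryD
      matrix_mul_assoc[symmetric])

text \<open>Orthonormal eigenvectors must be orthogonal over the complex numbers, which is stronger
  than \<open>x \<bullet> y = 0\<close>. The product is conjugate-linear in its first
  argument.\<close>

definition cinner_vec :: "complex^'n \<Rightarrow> complex^'n \<Rightarrow> complex" where
  "cinner_vec x y = (\<Sum>i\<in>UNIV. cnj (x $ i) * y $ i)"

lemma Re_cinner_vec: "Re (cinner_vec x y) = x \<bullet> y"
  by (simp add: cinner_vec_def inner_vec_def inner_complex_def)

lemma cinner_vec_self: "cinner_vec x x = of_real ((norm x)\<^sup>2)"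
proof -
  have "Im (cinner_vec x x) = 0" by (simp add: cinner_vec_def)
  then show ?thesis
    by (simp add: complex_eq_iff Re_cinner_vec power2_norm_eq_inner)
qed

lemma cinner_vec_commute: "cinner_vec y x = cnj (cinner_vec x y)"
  by (simp add: cinner_vec_def mult.commute)

lemma cinner_vec_scaleR_left: "cinner_vec (r *\<^sub>R x) y = of_real r * cinner_vec x y"
  by (simp add: cinner_vec_def sum_distrib_left scaleR_conv_of_real[where 'a=complex] mult.assoc)

lemma cinner_vec_adjoint: "cinner_vec x (A *v y) = cinner_vec (dagger A *v x) y"
proof -
  have "cinner_vec x (A *v y) = (\<Sum>i\<in>UNIV. \<Sum>j\<in>UNIV. cnj (x $ i) * (A $ i $ j * y $ j))"
    by (simp add: cinner_vec_def matrix_vector_mult_def sum_distrib_left)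
  also have "\<dots> = (\<Sum>j\<in>UNIV. \<Sum>i\<in>UNIV. cnj (x $ i) * (A $ i $ j * y $ j))"
    by (rule sum.swap)
  also have "\<dots> = cinner_vec (dagger A *v x) y"
    by (simp add: cinner_vec_def matrix_vector_mult_def sum_distrib_left sum_distrib_right mult_ac)
  finally show ?thesis .
qed

lemma inner_matrix_vector_adjoint: "x \<bullet> (A *v y) = (dagger A *v x) \<bullet> y"
  for A :: "complex^'n^'n"
  by (metis Re_cinner_vec cinner_vec_adjoint)

lemma positive_semidefinite_iff:
  "positive_semidefinite A \<longleftrightarrow> hermitian A \<and> (\<forall>v. 0 \<le> v \<bullet> (A *v v))"
  unfolding positive_semidefinite_def Re_cinner_vec[symmetric] cinner_vec_def by simp

lemma linear_matrix_vector_mult_complex: "linear ((*v) (A :: complex^'n^'n))"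
  by (intro linearI) (simp_all add: vec_eq_iff matrix_vector_mult_def sum.distrib
      algebra_simps scaleR_sum_right)

text \<open>The maximum of the Rayleigh quotient on the unit sphere of the subspace is an eigenvalue.\<close>

lemma selfadjoint_eigenvector_in_subspace:
  fixes f :: "'a::euclidean_space \<Rightarrow> 'a"
  assumes "linear f" and S: "subspace S" and inv: "\<And>x. x \<in> S \<Longrightarrow> f x \<in> S"
    and sa: "\<And>x y. x \<in> S \<Longrightarrow> y \<in> S \<Longrightarrow> x \<bullet> f y = f x \<bullet> y"
    and "z \<in> S" "z \<noteq> 0"
  obtains v \<mu> where "v \<in> S" "norm v = 1" "f v = \<mu> *\<^sub>R v"
proof -
  interpret linear f by fact
  let ?C = "S \<inter> sphere 0 1"
  have "compact ?C"
    by (simp add: closed_Int_compact closed_subspace S)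
  moreover have "z /\<^sub>R norm z \<in> ?C"
    using assms by (simp add: subspace_mul)
  then have "?C \<noteq> {}" by blast
  moreover have "continuous_on ?C (\<lambda>x. x \<bullet> f x)"
    by (intro continuous_intros linear_continuous_on) (simp add: \<open>linear f\<close> linear_linear)
  ultimately obtain v where v: "v \<in> ?C" and max: "\<And>y. y \<in> ?C \<Longrightarrow> y \<bullet> f y \<le> v \<bullet> f v"
    using continuous_attains_sup[of ?C "\<lambda>x. x \<bullet> f x"] by blast
  define \<mu> where "\<mu> = v \<bullet> f v"
  have vS: "v \<in> S" and nv: "norm v = 1" and vv: "v \<bullet> v = 1"
    using v by (auto simp: dot_square_norm)
  \<comment> \<open>\<open>q\<close> is the quadratic form of \<open>\<mu> - f\<close>: nonnegative
    on \<open>S\<close> by maximality of \<open>\<mu>\<close>, and zero at \<open>v\<close>.\<close>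
  define q where "q x = \<mu> * (x \<bullet> x) - x \<bullet> f x" for x
  have q_nonneg: "q x \<ge> 0" if "x \<in> S" for x
  proof (cases "x = 0")
    case False
    let ?y = "x /\<^sub>R norm x"
    have "?y \<bullet> f ?y \<le> \<mu>"
      unfolding \<mu>_def using False that S by (intro max) (simp add: subspace_mul)
    then have "x \<bullet> f x / (norm x)\<^sup>2 \<le> \<mu>"
      by (simp add: scale power2_eq_square divide_inverse mult_ac)
    then show ?thesis
      using False by (simp add: q_def divide_simps power2_norm_eq_inner mult_ac)
  qed (simp add: q_def zero)
  \<comment> \<open>\<open>w\<close> is the residual of the eigenvalue equation. Moving from
    \<open>v\<close> in the direction \<open>- w\<close> changes \<open>q\<close> to first order by
    \<open>- 2 * t * (w \<bullet> w)\<close>, which would make \<open>q\<close> negative unless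
    \<open>w = 0\<close>.\<close>
  define w where "w = \<mu> *\<^sub>R v - f v"
  have wS: "w \<in> S"
    unfolding w_def using vS inv S by (intro subspace_diff subspace_mul)
  have qv: "\<mu> * (v \<bullet> v) - v \<bullet> f v = 0" using vv by (simp add: \<mu>_def)
  have "q (v - t *\<^sub>R w) = t\<^sup>2 * q w - 2 * t * (w \<bullet> w)" for t
  proof -
    have "q (v - t *\<^sub>R w) = (\<mu> * (v \<bullet> v) - v \<bullet> f v) + t\<^sup>2 * q w
        - t * (2 * \<mu> * (w \<bullet> v) - w \<bullet> f v - v \<bullet> f w)"
      by (simp add: q_def diff scale inner_diff_left inner_diff_right inner_commute
          power2_eq_square algebra_simps)
    also have "v \<bullet> f w = w \<bullet> f v" using sa[OF vS wS] by (simp add: inner_commute)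
    also have "2 * \<mu> * (w \<bullet> v) - w \<bullet> f v - w \<bullet> f v = 2 * (w \<bullet> w)"
      by (simp add: w_def inner_diff_right inner_diff_left algebra_simps)
    finally show ?thesis using qv by simp
  qed
  then have key: "0 \<le> t\<^sup>2 * q w - 2 * t * (w \<bullet> w)" for t
    using q_nonneg[of "v - t *\<^sub>R w"] vS wS S
    by (metis subspace_diff subspace_mul)
  have "w \<bullet> w = 0"
  proof (rule ccontr)
    assume "w \<bullet> w \<noteq> 0"
    then have pos: "w \<bullet> w > 0" by simp
    \<comment> \<open>This \<open>t\<close> is small enough for the quadratic term not to outweigh
      the linear one; adding 1 avoids division by zero.\<close>
    define t where "t = (w \<bullet> w) / (q w + 1)"
    have "q w \<ge> 0" by (rule q_nonneg[OF wS])
    then have "t > 0" and "t * q w \<le> w \<bullet> w"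
      using pos by (simp_all add: t_def field_simps)
    then have "t * (t * q w - 2 * (w \<bullet> w)) < 0"
      using pos by (intro mult_pos_neg) linarith+
    then show False using key[of t] by (simp add: power2_eq_square algebra_simps)
  qed
  then have "f v = \<mu> *\<^sub>R v" by (simp add: w_def)
  with vS nv show thesis by (rule that)
qed

text \<open>Put the conjugated vectors into the rows of a square matrix, with zero rows outside
  \<open>F\<close>. Row \<open>j\<close> vanishes, so the matrix is singular, and a nonzero kernel
  vector is orthogonal to every \<open>e i\<close> with \<open>i\<close> in
  \<open>F\<close>.\<close>

lemma exists_orthogonal_vector:
  fixes e :: "'n \<Rightarrow> complex^'n"
  assumes "j \<notin> F"
  shows "\<exists>x. x \<noteq> 0 \<and> (\<forall>i\<in>F. cinner_vec (e i) x = 0)"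
proof -
  define E :: "complex^'n^'n" where "E = (\<chi> i k. if i \<in> F then cnj (e i $ k) else 0)"
  have "\<nexists>B. E ** B = mat 1"
  proof
    assume "\<exists>B. E ** B = mat 1"
    then obtain B where "E ** B = mat 1" ..
    then have "(E ** B) $ j $ j = 1" by (simp add: mat_def)
    then show False using assms by (simp add: E_def matrix_matrix_mult_def)
  qed
  then have "\<nexists>B. B ** E = mat 1" by (simp add: matrix_left_right_inverse)
  then obtain x where x: "E *v x = 0" "x \<noteq> 0"
    using matrix_left_invertible_ker by blast
  have "cinner_vec (e i) x = 0" if "i \<in> F" for i
  proof -
    have "(E *v x) $ i = cinner_vec (e i) x"
      using that by (simp add: E_def matrix_vector_mult_def cinner_vec_def)
    then show ?thesis using x by simp
  qed
  with x(2) show ?thesis by blast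
qed

text \<open>Arbitrary index sets \<open>F\<close> allow an induction that adds one eigenvector at a
  time, found in the orthogonal complement of the earlier ones; \<open>F = UNIV\<close> gives an
  eigenbasis.\<close>

lemma hermitian_orthonormal_eigenvectors:
  fixes A :: "complex^'n^'n"
  assumes "hermitian A"
  shows "\<exists>(e :: 'n \<Rightarrow> complex^'n) d.
    (\<forall>i\<in>F. \<forall>j\<in>F. cinner_vec (e i) (e j) = (if i = j then 1 else 0))
    \<and> (\<forall>i\<in>F. A *v e i = d i *\<^sub>R e i)"
  using finite[of F]
proof (induction F)
  case empty
  then show ?case by simp
next
  case (insert k F)
  then obtain e d
    where orth: "\<And>i j. i \<in> F \<Longrightarrow> j \<in> F \<Longrightarrow> cinner_vec (e i) (e j) = (if i = j then 1 else 0)"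
      and eig: "\<And>i. i \<in> F \<Longrightarrow> A *v e i = d i *\<^sub>R e i"
    by blast
  \<comment> \<open>The complex orthogonal complement of the eigenvectors found so far. It is
    invariant since moving \<open>A\<close> onto \<open>e i\<close> only produces the factor
    \<open>d i\<close>, and it is nontrivial since \<open>k\<close> is not in
    \<open>F\<close>.\<close>
  define S where "S = {x. \<forall>i\<in>F. cinner_vec (e i) x = 0}"
  have S: "subspace S"
    unfolding subspace_def S_def
    by (auto simp: cinner_vec_def algebra_simps sum.distrib scaleR_sum_right[symmetric])
  have inv: "A *v x \<in> S" if "x \<in> S" for x
    using that assms eig
    by (simp add: S_def cinner_vec_adjoint hermitian_def cinner_vec_scaleR_left)
  have sa: "x \<bullet> (A *v y) = (A *v x) \<bullet> y" for x y
    using assms by (simp add: inner_matrix_vector_adjoint hermitian_def)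
  obtain z where "z \<noteq> 0" and "\<forall>i\<in>F. cinner_vec (e i) z = 0"
    using exists_orthogonal_vector[OF insert.hyps(2), of e] by (elim exE conjE)
  then have z: "z \<in> S" "z \<noteq> 0" by (simp_all add: S_def)
  obtain v \<mu> where v: "v \<in> S" "norm v = 1" "A *v v = \<mu> *\<^sub>R v"
    using selfadjoint_eigenvector_in_subspace[OF linear_matrix_vector_mult_complex S inv sa z] .
  have vv: "cinner_vec v v = 1" using v(2) by (simp add: cinner_vec_self)
  have ev: "cinner_vec (e i) v = 0" "cinner_vec v (e i) = 0" if "i \<in> F" for i
    using v(1) that by (simp_all add: S_def cinner_vec_commute[of v])
  let ?e = "e(k := v)" and ?d = "d(k := \<mu>)"
  have "(\<forall>i\<in>insert k F. \<forall>j\<in>insert k F. cinner_vec (?e i) (?e j) = (if i = j then 1 else 0))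
    \<and> (\<forall>i\<in>insert k F. A *v ?e i = ?d i *\<^sub>R ?e i)"
    using orth eig vv ev v(3) insert.hyps(2) by auto
  then show ?case by blast
qed

definition real_diag :: "('n \<Rightarrow> real) \<Rightarrow> complex^'n^'n" where
  "real_diag d = (\<chi> i j. if i = j then of_real (d i) else 0)"

lemma dagger_real_diag [simp]: "dagger (real_diag d) = real_diag d"
  by (simp add: vec_eq_iff real_diag_def)

lemma matrix_mult_real_diag: "(A ** real_diag d) $ i $ j = A $ i $ j * of_real (d j)"
  by (simp add: real_diag_def matrix_matrix_mult_def if_distrib[of "\<lambda>x. _ * x"] cong: if_cong)

lemma real_diag_mult_matrix: "(real_diag d ** A) $ i $ j = of_real (d i) * A $ i $ j"
  by (simp add: real_diag_def matrix_matrix_mult_def if_distrib[of "\<lambda>x. x * _"] cong: if_cong)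

text \<open>With the orthonormal eigenvectors as columns of \<open>U\<close>, the eigenvalue
  equations read \<open>A ** U = U ** real_diag d\<close>.\<close>

theorem hermitian_spectral_theorem:
  fixes A :: "complex^'n^'n"
  assumes "hermitian A"
  obtains U d where "unitary U" "A = U ** real_diag d ** dagger U"
proof -
  obtain e :: "'n \<Rightarrow> complex^'n" and d where orth: "\<And>i j. cinner_vec (e i) (e j) = (if i = j then 1 else 0)"
    and eig: "\<And>i. A *v e i = d i *\<^sub>R e i"
    using hermitian_orthonormal_eigenvectors[OF assms, of UNIV] by auto
  define U where "U = (\<chi> i j. e j $ i)"
  have "dagger U ** U = mat 1"
    using orth by (simp add: vec_eq_iff U_def matrix_matrix_mult_def mat_def cinner_vec_def)
  then have U: "unitary U"
    by (simp add: unitary_def matrix_left_right_inverse)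
  have "A ** U = U ** real_diag d"
  proof -
    have "(A ** U) $ i $ j = (A *v e j) $ i" for i j
      by (simp add: U_def matrix_matrix_mult_def matrix_vector_mult_def)
    then show ?thesis
      by (simp add: vec_eq_iff matrix_mult_real_diag eig U_def scaleR_conv_of_real[where 'a=complex])
  qed
  then have "A = U ** real_diag d ** dagger U"
    using unitaryD(6)[OF U, of A] by simp
  with U show thesis by (rule that)
qed

section \<open>Square roots and fidelity\<close>

lemma real_diag_mult: "real_diag a ** real_diag b = real_diag (\<lambda>i. a i * b i)"
  by (simp add: vec_eq_iff matrix_mult_real_diag) (simp add: real_diag_def)

lemma Re_trace_real_diag: "Re (trace (real_diag d)) = sum d UNIV"
  by (simp add: trace_def real_diag_def)

lemma real_diag_mult_axis: "real_diag d *v axis i 1 = d i *\<^sub>R axis i 1"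
  by (simp add: vec_eq_iff matrix_vector_mult_def real_diag_def axis_def
      scaleR_conv_of_real[where 'a=complex] if_distrib[of "\<lambda>x. _ * x"] cong: if_cong)

lemma norm_row_square: "of_real ((norm (A $ i))\<^sup>2) = (A ** dagger A) $ i $ i"
  for A :: "complex^'n^'n"
proof -
  have "(A ** dagger A) $ i $ i = cinner_vec (A $ i) (A $ i)"
    by (simp add: matrix_matrix_mult_def cinner_vec_def mult.commute)
  then show ?thesis by (simp add: cinner_vec_self)
qed

section \<open>Positive semidefinite matrices and uniqueness of their square roots\<close>

lemma positive_semidefinite_conjugate:
  assumes "positive_semidefinite A"
  shows "positive_semidefinite (X ** A ** dagger X)"
proof -
  have "v \<bullet> ((X ** A ** dagger X) *v v) = (dagger X *v v) \<bullet> (A *v (dagger X *v v))" for v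
    by (simp add: matrix_vector_mul_assoc[symmetric] inner_matrix_vector_adjoint[of v X])
  with assms show ?thesis
    by (simp add: positive_semidefinite_iff hermitian_def dagger_mult matrix_mul_assoc)
qed

lemma positive_semidefinite_mat_1: "positive_semidefinite (mat 1)"
  by (simp add: positive_semidefinite_iff hermitian_def)

lemma positive_semidefinite_mult_dagger: "positive_semidefinite (X ** dagger X)"
  using positive_semidefinite_conjugate[OF positive_semidefinite_mat_1, of X] by simp

lemma positive_semidefinite_real_diag:
  assumes "\<And>i. 0 \<le> d i"
  shows "positive_semidefinite (real_diag d)"
proof -
  have "real_diag d = real_diag (\<lambda>i. sqrt (d i)) ** dagger (real_diag (\<lambda>i. sqrt (d i)))"
    using assms by (simp add: real_diag_mult)
  then show ?thesis by (metis positive_semidefinite_mult_dagger)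
qed

lemma diagonalization_eigenvector:
  assumes U: "unitary U" and A: "A = U ** real_diag d ** dagger U"
  defines "v \<equiv> \<lambda>i. U *v axis i 1"
  shows "A *v v i = d i *\<^sub>R v i" "v i \<bullet> v i = 1"
proof -
  have "A *v v i = U *v (real_diag d *v axis i 1)"
    using unitaryD[OF U]
    by (simp add: A v_def matrix_vector_mul_assoc matrix_mul_assoc[symmetric])
  also have "\<dots> = d i *\<^sub>R v i"
    by (simp add: real_diag_mult_axis v_def linear_cmul[OF linear_matrix_vector_mult_complex])
  finally show "A *v v i = d i *\<^sub>R v i" .
  have "v i \<bullet> v i = (dagger U *v (U *v axis i 1)) \<bullet> axis i 1"
    by (simp add: v_def inner_matrix_vector_adjoint)
  then show "v i \<bullet> v i = 1"
    using unitaryD(1)[OF U] by (simp add: matrix_vector_mul_assoc inner_axis_axis)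
qed

text \<open>Equal squares give \<open>B ** (B - C) + (B - C) ** C = 0\<close>. On a unit eigenvector
  \<open>v\<close> of \<open>B - C\<close> with eigenvalue \<open>d\<close>, this says that
  \<open>d\<close> times the sum of the quadratic forms of \<open>B\<close> and \<open>C\<close>
  vanishes, while \<open>d\<close> is their difference. As both forms are nonnegative,
  \<open>d = 0\<close>.\<close>

lemma positive_semidefinite_sqrt_unique:
  assumes B: "positive_semidefinite B" and C: "positive_semidefinite C" and eq: "B ** B = C ** C"
  shows "B = C"
proof -
  have "hermitian (B - C)"
    using B C by (simp add: positive_semidefinite_iff hermitian_def dagger_diff)
  then obtain U d where U: "unitary U" and D: "B - C = U ** real_diag d ** dagger U"
    by (rule hermitian_spectral_theorem)
  have "d i = 0" for i
  proof -
    define v where "v = U *v axis i 1"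
    have Dv: "(B - C) *v v = d i *\<^sub>R v" and vv: "v \<bullet> v = 1"
      using diagonalization_eigenvector[OF U D, of i] by (simp_all add: v_def)
    have "B ** (B - C) + (B - C) ** C = 0"
      using eq by (simp add: matrix_diff_left matrix_diff_right)
    then have "0 = v \<bullet> ((B ** (B - C) + (B - C) ** C) *v v)" by simp
    also have "\<dots> = v \<bullet> (B *v ((B - C) *v v)) + (dagger (B - C) *v v) \<bullet> (C *v v)"
      by (simp add: matrix_vector_mult_add_rdistrib inner_add_right
          matrix_vector_mul_assoc[symmetric] inner_matrix_vector_adjoint[of v "B - C"])
    also have "\<dots> = v \<bullet> (B *v ((B - C) *v v)) + ((B - C) *v v) \<bullet> (C *v v)"
      using \<open>hermitian (B - C)\<close> by (simp only: hermitian_def)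
    also have "\<dots> = d i * (v \<bullet> (B *v v) + v \<bullet> (C *v v))"
      unfolding Dv by (simp add: linear_cmul[OF linear_matrix_vector_mult_complex] algebra_simps)
    finally have 0: "d i * (v \<bullet> (B *v v) + v \<bullet> (C *v v)) = 0" by simp
    have nonneg: "v \<bullet> (B *v v) \<ge> 0" "v \<bullet> (C *v v) \<ge> 0"
      using B C by (simp_all add: positive_semidefinite_iff)
    have "d i = v \<bullet> ((B - C) *v v)" using vv by (simp add: Dv)
    also have "\<dots> = v \<bullet> (B *v v) - v \<bullet> (C *v v)"
      by (simp add: matrix_vector_mult_diff_rdistrib inner_diff_right)
    finally show ?thesis using 0 nonneg by (auto simp: add_nonneg_eq_0_iff)
  qed
  then have "real_diag d = 0" by (simp add: vec_eq_iff real_diag_def)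
  then have "B - C = 0"
    using D bounded_bilinear.zero_left[OF bounded_bilinear_matrix_mult]
      bounded_bilinear.zero_right[OF bounded_bilinear_matrix_mult] by metis
  then show ?thesis by simp
qed

lemma op_sqrt_square:
  assumes "positive_semidefinite R"
  shows "op_sqrt (R ** R) = R"
  unfolding op_sqrt_def
  using assms positive_semidefinite_sqrt_unique by (intro the_equality) blast+

text \<open>The eigenvalues are written as squares so that the square root is obtained by replacing
  \<open>(p i)\<^sup>2\<close> with \<open>p i\<close>.\<close>

lemma positive_semidefinite_diagonalization:
  assumes "positive_semidefinite A"
  obtains U p where "unitary U" "\<forall>i. 0 \<le> p i" "A = U ** real_diag (\<lambda>i. (p i)\<^sup>2) ** dagger U"
proof -
  obtain U d where U: "unitary U" and A: "A = U ** real_diag d ** dagger U"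
    using hermitian_spectral_theorem assms unfolding positive_semidefinite_iff by metis
  have "0 \<le> d i" for i
  proof -
    define v where "v = U *v axis i 1"
    have "d i = v \<bullet> (A *v v)"
      using diagonalization_eigenvector[OF U A, of i] by (simp add: v_def)
    then show ?thesis using assms by (simp add: positive_semidefinite_iff)
  qed
  then show thesis
    using that[of U "\<lambda>i. sqrt (d i)"] U A by simp
qed

lemma positive_semidefinite_sqrt:
  assumes U: "unitary U" and p: "\<And>i. 0 \<le> p i"
  defines "P \<equiv> U ** real_diag p ** dagger U"
  shows "positive_semidefinite P" "P ** P = U ** real_diag (\<lambda>i. (p i)\<^sup>2) ** dagger U"
proof -
  show "positive_semidefinite P"
    unfolding P_def by (intro positive_semidefinite_conjugate positive_semidefinite_real_diag p)
  have "P ** P = U ** real_diag p ** (dagger U ** U) ** real_diag p ** dagger U"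
    by (simp add: P_def matrix_mul_assoc)
  also have "\<dots> = U ** (real_diag p ** real_diag p) ** dagger U"
    using unitaryD(1)[OF U] by (simp add: matrix_mul_assoc)
  finally show "P ** P = U ** real_diag (\<lambda>i. (p i)\<^sup>2) ** dagger U"
    by (simp add: real_diag_mult power2_eq_square)
qed

lemma exists_positive_semidefinite_sqrt:
  assumes "positive_semidefinite A"
  obtains R where "positive_semidefinite R" "A = R ** R"
proof -
  obtain U p where U: "unitary U" and p: "\<forall>i. 0 \<le> p i"
    and A: "A = U ** real_diag (\<lambda>i. (p i)\<^sup>2) ** dagger U"
    using positive_semidefinite_diagonalization[OF assms] .
  show thesis
    using positive_semidefinite_sqrt[OF U, of p] p A by (intro that) auto
qed

text \<open>One half of Uhlmann's theorem, for the purification \<open>R = \<surd>\<rho>\<close> of \<open>\<rho>\<close> and an arbitrary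
  purification \<open>B\<close> of \<open>\<sigma>\<close>. With \<open>R B = U G\<close>, where \<open>U\<close> diagonalizes \<open>R \<sigma> R\<close>, the
  rows of \<open>G\<close> are orthogonal and their norms are the eigenvalues of \<open>\<surd>(R \<sigma> R)\<close>.\<close>

lemma fidelity_purification_bounds:
  fixes R B :: "complex^'n^'n"
  assumes R: "positive_semidefinite R" and nR: "norm R = 1" and nB: "norm B = 1"
  shows "R \<bullet> B \<le> sqrt (fidelity (R ** R) (B ** dagger B))"
    and "sqrt (fidelity (R ** R) (B ** dagger B)) \<le> 1"
proof -
  define C where "C = R ** B"
  have hR: "dagger R = R" using R by (simp add: positive_semidefinite_iff hermitian_def)
  have CC: "R ** (B ** dagger B) ** R = C ** dagger C"
    by (simp add: C_def dagger_mult hR matrix_mul_assoc)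
  obtain U p where U: "unitary U" and "\<forall>i. 0 \<le> p i"
    and diag: "C ** dagger C = U ** real_diag (\<lambda>i. (p i)\<^sup>2) ** dagger U"
    using positive_semidefinite_diagonalization[OF positive_semidefinite_mult_dagger] .
  then have p: "0 \<le> p i" for i by blast
  define P where "P = U ** real_diag p ** dagger U"
  have "op_sqrt (C ** dagger C) = P"
    using op_sqrt_square[OF positive_semidefinite_sqrt(1)[OF U, of p]]
    by (simp add: diag P_def positive_semidefinite_sqrt(2)[OF U] p)
  moreover have "Re (trace P) = sum p UNIV"
    unfolding P_def trace_mul_sym[of "U ** real_diag p"] using U
    by (simp add: matrix_mul_assoc unitaryD Re_trace_real_diag)
  ultimately have fid: "sqrt (fidelity (R ** R) (B ** dagger B)) = sum p UNIV"
    using p by (simp add: fidelity_def op_sqrt_square R CC sum_nonneg)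

  define G where "G = dagger U ** C"
  have GG: "G ** dagger G = real_diag (\<lambda>i. (p i)\<^sup>2)"
  proof -
    have "G ** dagger G = dagger U ** (C ** dagger C) ** U"
      by (simp add: G_def dagger_mult matrix_mul_assoc)
    then show ?thesis using U by (simp add: diag unitaryD matrix_mul_assoc)
  qed
  have nG: "norm (G $ i) = p i" for i
  proof -
    have "complex_of_real ((norm (G $ i))\<^sup>2) = of_real ((p i)\<^sup>2)"
      unfolding norm_row_square GG by (simp add: real_diag_def)
    then show ?thesis using p[of i] by (simp only: of_real_eq_iff power2_eq_iff_nonneg norm_ge_zero)
  qed
  have nU: "norm (dagger U $ i) = 1" for i
  proof -
    have "complex_of_real ((norm (dagger U $ i))\<^sup>2) = of_real 1"
      unfolding norm_row_square using U by (simp add: unitaryD mat_def)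
    then have "(norm (dagger U $ i))\<^sup>2 = 1\<^sup>2" by (simp only: of_real_eq_iff power_one)
    then show ?thesis by (rule power2_eq_imp_eq) simp_all
  qed
  have C: "C = U ** G" using U by (simp add: G_def unitaryD)
  \<comment> \<open>The overlap is the real trace of \<open>U ** G\<close>, a sum of inner products
    of rows. Cauchy-Schwarz in each row bounds it by the sum of the \<open>p i\<close>, since the
    rows of \<open>dagger U\<close> are unit vectors.\<close>
  have "R \<bullet> B = mat 1 \<bullet> C"
    using inner_matrix_adjoint_left[of R "mat 1" B] by (simp add: C_def hR)
  also have "\<dots> = dagger U \<bullet> G"
    using inner_matrix_adjoint_left[of "dagger U" "mat 1" G] by (simp add: C)
  also have "\<dots> = (\<Sum>i\<in>UNIV. dagger U $ i \<bullet> G $ i)" by (simp add: inner_vec_def)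
  also have "\<dots> \<le> (\<Sum>i\<in>UNIV. norm (dagger U $ i) * norm (G $ i))"
    by (intro sum_mono norm_cauchy_schwarz)
  finally show "R \<bullet> B \<le> sqrt (fidelity (R ** R) (B ** dagger B))"
    by (simp add: fid nU nG)

  \<comment> \<open>\<open>V\<close> has the normalized rows of \<open>G\<close> (zero rows are kept, as \<open>inverse 0 = 0\<close>), hence it is
    a partial isometry.\<close>
  define V where "V = real_diag (\<lambda>i. inverse (p i)) ** G"
  define E where "E = (real_diag (\<lambda>i. if p i = 0 then 0 else 1) :: complex^'n^'n)"
  have "V ** dagger V = real_diag (\<lambda>i. inverse (p i)) ** (G ** dagger G) ** real_diag (\<lambda>i. inverse (p i))"
    by (simp add: V_def dagger_mult matrix_mul_assoc)
  also have "\<dots> = real_diag (\<lambda>i. inverse (p i) * (p i)\<^sup>2 * inverse (p i))"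
    by (simp add: GG real_diag_mult)
  also have "(\<lambda>i. inverse (p i) * (p i)\<^sup>2 * inverse (p i)) = (\<lambda>i. if p i = 0 then 0 else 1)"
    by (auto simp: fun_eq_iff power2_eq_square divide_simps)
  finally have VV: "V ** dagger V = E" by (simp add: E_def)
  have "E ** V = real_diag (\<lambda>i. (if p i = 0 then 0 else 1) * inverse (p i)) ** G"
    by (simp add: E_def V_def matrix_mul_assoc real_diag_mult)
  also have "(\<lambda>i. (if p i = 0 then 0 else 1) * inverse (p i)) = (\<lambda>i. inverse (p i))"
    by auto
  finally have EV: "E ** V = V" by (simp add: V_def)
  have VE: "dagger V ** E = dagger V"
    using arg_cong[OF EV, of dagger] by (simp add: dagger_mult E_def)
  \<comment> \<open>\<open>Y ** V\<close> is the orthogonal projection of \<open>B\<close> given by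
    right multiplication with \<open>dagger V ** V\<close>. It has the same norm as
    \<open>Y\<close>, so Pythagoras gives \<open>norm Y \<le> norm B\<close>.\<close>
  define Y where "Y = B ** dagger V"
  have YV: "norm Y \<le> 1"
  proof -
    have BY: "B \<bullet> (Y ** V) = Y \<bullet> Y"
      using inner_matrix_adjoint_right[of Y V B] by (simp add: Y_def inner_commute)
    have YY: "(Y ** V) \<bullet> (Y ** V) = Y \<bullet> Y"
      by (simp add: inner_matrix_adjoint_right matrix_mul_assoc[symmetric] VV)
         (simp add: Y_def matrix_mul_assoc[symmetric] VE)
    have "0 \<le> (B - Y ** V) \<bullet> (B - Y ** V)" by simp
    also have "\<dots> = B \<bullet> B - 2 * (B \<bullet> (Y ** V)) + (Y ** V) \<bullet> (Y ** V)"
      by (simp add: inner_diff_left inner_diff_right inner_commute)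
    also have "\<dots> = B \<bullet> B - Y \<bullet> Y" by (simp add: BY YY)
    finally have "(norm Y)\<^sup>2 \<le> 1" using nB by (simp add: power2_norm_eq_inner[symmetric])
    then show ?thesis by (simp add: power_le_one_iff)
  qed
  \<comment> \<open>The row inner products of \<open>V\<close> and \<open>G\<close> recover the
    \<open>p i\<close>. Moving \<open>U\<close>, \<open>R\<close> and \<open>V\<close> across the
    inner product leaves one overlap of matrices of norm at most 1.\<close>
  have "sum p UNIV = (\<Sum>i\<in>UNIV. V $ i \<bullet> G $ i)"
  proof (rule sum.cong)
    fix i
    have "V $ i = inverse (p i) *\<^sub>R G $ i"
      by (simp add: vec_eq_iff V_def real_diag_mult_matrix scaleR_conv_of_real[where 'a=complex])
    then have "V $ i \<bullet> G $ i = inverse (p i) * (p i)\<^sup>2"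
      by (simp add: nG[symmetric] power2_norm_eq_inner)
    then show "p i = V $ i \<bullet> G $ i" by (cases "p i = 0") (simp_all add: power2_eq_square)
  qed simp
  also have "\<dots> = V \<bullet> (dagger U ** R ** B)"
    by (simp add: inner_vec_def G_def C_def matrix_mul_assoc)
  also have "\<dots> = (R ** U) \<bullet> Y"
    using inner_matrix_adjoint_left[of "R ** U" V B] inner_matrix_adjoint_right[of "R ** U" V B]
    by (simp add: Y_def dagger_mult hR)
  also have "\<dots> \<le> norm (R ** U) * norm Y" by (rule norm_cauchy_schwarz)
  also have "\<dots> \<le> 1" using U YV by (simp add: norm_mult_unitary nR)
  finally show "sqrt (fidelity (R ** R) (B ** dagger B)) \<le> 1" by (simp add: fid)
qed

section \<open>Linear differential equations and curves on the sphere\<close>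

text \<open>The solution is the sum of the Picard terms \<open>u\<^sub>n\<close> with \<open>u\<^sub>n\<^sub>+\<^sub>1(t) = \<integral>\<^sub>0\<^sup>t B(A, u\<^sub>n)\<close>.\<close>

theorem linear_ode_solution_exists:
  fixes B :: "'a::real_normed_vector \<Rightarrow> 'b::banach \<Rightarrow> 'b" and A :: "real \<Rightarrow> 'a"
  assumes "bounded_bilinear B" and "0 \<le> \<tau>" and A: "continuous_on {0..\<tau>} A"
  shows "\<exists>x. x 0 = x0 \<and>
    (\<forall>t\<in>{0..\<tau>}. (x has_vector_derivative B (A t) (x t)) (at t within {0..\<tau>}))"
proof -
  interpret bounded_bilinear B by fact
  define u where "u = rec_nat (\<lambda>_. x0) (\<lambda>_ v t. integral {0..t} (\<lambda>s. B (A s) (v s)))"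
  have u0: "u 0 = (\<lambda>_. x0)" and uS: "\<And>n. u (Suc n) = (\<lambda>t. integral {0..t} (\<lambda>s. B (A s) (u n s)))"
    by (simp_all add: u_def)
  obtain K where K: "0 < K" "\<And>a b. norm (B a b) \<le> norm a * norm b * K"
    using pos_bounded by blast
  have "bounded (A ` {0..\<tau>})"
    by (intro compact_imp_bounded compact_continuous_image A) simp
  then obtain a where a: "\<And>t. t \<in> {0..\<tau>} \<Longrightarrow> norm (A t) \<le> a"
    unfolding bounded_iff by blast
  define C where "C = a * K"
  have prod_le: "norm (B (A t) v) \<le> C * norm v" if "t \<in> {0..\<tau>}" for t v
  proof -
    have "norm (B (A t) v) \<le> norm (A t) * norm v * K" by (rule K)
    also have "\<dots> \<le> a * norm v * K"
      using a[OF that] K by (intro mult_right_mono) auto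
    finally show ?thesis by (simp add: C_def mult_ac)
  qed
  have "0 \<le> a" using a[of 0] \<open>0 \<le> \<tau>\<close> norm_ge_zero[of "A 0"] by (meson atLeastAtMost_iff order.trans order_refl)
  then have C0: "0 \<le> C" using K by (simp add: C_def)
  have step: "(u (Suc n) has_vector_derivative B (A t) (u n t)) (at t within {0..\<tau>})"
    if "continuous_on {0..\<tau>} (u n)" "t \<in> {0..\<tau>}" for n t
    unfolding uS
    by (rule integral_has_vector_derivative[OF continuous_on[OF A that(1)] that(2)])
  have cont: "continuous_on {0..\<tau>} (u n)" for n
  proof (induction n)
    case (Suc n)
    then show ?case
      using step[OF Suc] has_vector_derivative_continuous continuous_on_eq_continuous_within by blast
  qed (simp add: u0)
  \<comment> \<open>The factorial comes from integrating \<open>s ^ n\<close> at each Picard step;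
    it makes the series converge on the whole interval, however large \<open>C * \<tau>\<close>
    is.\<close>
  have bound: "norm (u n t) \<le> norm x0 * (C ^ n * t ^ n / fact n)" if "t \<in> {0..\<tau>}" for n t
    using that
  proof (induction n arbitrary: t)
    case (Suc n)
    have sub: "{0..t} \<subseteq> {0..\<tau>}" using Suc.prems by auto
    have "((\<lambda>s. norm x0 * (C ^ Suc n * s ^ n / fact n)) has_integral
        norm x0 * (C ^ Suc n * t ^ Suc n / fact (Suc n)) - norm x0 * (C ^ Suc n * 0 ^ Suc n / fact (Suc n))) {0..t}"
    proof (rule fundamental_theorem_of_calculus)
      fix s :: real
      have "((\<lambda>s. norm x0 * (C ^ Suc n * s ^ Suc n / fact (Suc n))) has_real_derivative
          norm x0 * (C ^ Suc n * (real (Suc n) * s ^ n) / fact (Suc n))) (at s within {0..t})"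
        by (intro derivative_eq_intros refl | simp)+
      also have "C ^ Suc n * (real (Suc n) * s ^ n) / fact (Suc n) = C ^ Suc n * s ^ n / fact n"
        by (simp add: fact_Suc divide_simps del: of_nat_Suc)
      finally show "((\<lambda>s. norm x0 * (C ^ Suc n * s ^ Suc n / fact (Suc n))) has_vector_derivative
          norm x0 * (C ^ Suc n * s ^ n / fact n)) (at s within {0..t})"
        by (simp add: has_real_derivative_iff_has_vector_derivative)
    qed (use Suc.prems in auto)
    then have int: "((\<lambda>s. norm x0 * (C ^ Suc n * s ^ n / fact n)) has_integral
        norm x0 * (C ^ Suc n * t ^ Suc n / fact (Suc n))) {0..t}" by simp
    have "norm (u (Suc n) t) \<le> integral {0..t} (\<lambda>s. norm x0 * (C ^ Suc n * s ^ n / fact n))"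
      unfolding uS
    proof (rule integral_norm_bound_integral)
      show "(\<lambda>s. B (A s) (u n s)) integrable_on {0..t}"
        by (intro integrable_continuous_real continuous_on_subset[OF _ sub] continuous_on A cont)
      show "(\<lambda>s. norm x0 * (C ^ Suc n * s ^ n / fact n)) integrable_on {0..t}"
        using int by blast
      fix s assume "s \<in> {0..t}"
      then have s: "s \<in> {0..\<tau>}" using sub by blast
      have "norm (B (A s) (u n s)) \<le> C * norm (u n s)" by (rule prod_le[OF s])
      also have "\<dots> \<le> C * (norm x0 * (C ^ n * s ^ n / fact n))"
        by (intro mult_left_mono Suc.IH s C0)
      finally show "norm (B (A s) (u n s)) \<le> norm x0 * (C ^ Suc n * s ^ n / fact n)"
        by (simp add: mult_ac)
    qed
    also have "\<dots> = norm x0 * (C ^ Suc n * t ^ Suc n / fact (Suc n))"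
      using int by (rule integral_unique)
    finally show ?case .
  qed (simp add: u0)
  define M where "M n = norm x0 * ((C * \<tau>) ^ n / fact n)" for n
  have "summable M"
    unfolding M_def by (intro summable_mult) (use summable_exp[of "C * \<tau>"] in \<open>simp add: divide_inverse mult.commute\<close>)
  have uM: "norm (u n t) \<le> M n" if "t \<in> {0..\<tau>}" for n t
  proof -
    have "C ^ n * t ^ n / fact n \<le> (C * \<tau>) ^ n / fact n"
      using that C0 by (auto simp: power_mult_distrib intro!: divide_right_mono mult_left_mono power_mono)
    then show ?thesis
      using bound[OF that, of n] unfolding M_def by (meson mult_left_mono norm_ge_zero order_trans)
  qed
  define x where "x t = (\<Sum>n. u n t)" for t
  have sums: "(\<lambda>n. u n t) sums x t" if "t \<in> {0..\<tau>}" for t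
    unfolding x_def
    by (intro summable_sums summable_comparison_test'[OF \<open>summable M\<close>] uM that)
  have unif: "uniform_limit {0..\<tau>} (\<lambda>n t. \<Sum>i<n. u i t) x sequentially"
    unfolding x_def using uM \<open>summable M\<close> by (rule Weierstrass_m_test)
  define u' where "u' n t = (case n of 0 \<Rightarrow> 0 | Suc m \<Rightarrow> B (A t) (u m t))" for n t
  have du: "(u n has_derivative (\<lambda>h. h *\<^sub>R u' n t)) (at t within {0..\<tau>})" if "t \<in> {0..\<tau>}" for n t
  proof (cases n)
    case (Suc m)
    then show ?thesis
      using step[OF cont that, of m] by (simp add: u'_def has_vector_derivative_def)
  qed (simp add: u0 u'_def)
  \<comment> \<open>The series is differentiated termwise. The resulting function \<open>g\<close>
    is identified with \<open>x\<close> afterwards, by uniqueness of sums.\<close>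
  have "\<exists>g. \<forall>t\<in>{0..\<tau>}. (\<lambda>n. u n t) sums g t \<and>
      (g has_derivative (\<lambda>h. h *\<^sub>R B (A t) (x t))) (at t within {0..\<tau>})"
  proof (rule has_derivative_series[where f' = "\<lambda>n t h. h *\<^sub>R u' n t"])
    fix e :: real assume "e > 0"
    \<comment> \<open>\<open>B (A t)\<close> enlarges the error of a partial sum by at most the
      factor \<open>C\<close>; dividing by \<open>C + 1\<close> also covers
      \<open>C = 0\<close>.\<close>
    then have "e / (C + 1) > 0" using C0 by simp
    then have "\<forall>\<^sub>F n in sequentially. \<forall>t\<in>{0..\<tau>}. dist (\<Sum>i<n. u i t) (x t) < e / (C + 1)"
      using unif unfolding uniform_limit_iff by blast
    then have ev: "\<forall>\<^sub>F n in sequentially. \<forall>t\<in>{0..\<tau>}. norm ((\<Sum>i<Suc n. u' i t) - B (A t) (x t)) \<le> e"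
    proof eventually_elim
      case (elim n)
      show ?case
      proof
        fix t assume t: "t \<in> {0..\<tau>}"
        \<comment> \<open>Index shift: the derivative of the constant term is 0, so the first
          \<open>n + 1\<close> derivatives come from only \<open>n\<close> Picard terms.\<close>
        have "(\<Sum>i<Suc n. u' i t) - B (A t) (x t) = B (A t) ((\<Sum>i<n. u i t) - x t)"
          by (simp add: sum.lessThan_Suc_shift u'_def sum_right diff_right del: sum.lessThan_Suc)
        then have "norm ((\<Sum>i<Suc n. u' i t) - B (A t) (x t)) \<le> C * dist (\<Sum>i<n. u i t) (x t)"
          using prod_le[OF t] by (simp add: dist_norm)
        also have "\<dots> \<le> C * (e / (C + 1))"
          using elim t C0 by (intro mult_left_mono) (auto intro: less_imp_le)
        also have "\<dots> \<le> e" using C0 \<open>e > 0\<close> by (simp add: field_simps)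
        finally show "norm ((\<Sum>i<Suc n. u' i t) - B (A t) (x t)) \<le> e" .
      qed
    qed
    have "\<forall>\<^sub>F n in sequentially. \<forall>t\<in>{0..\<tau>}. norm ((\<Sum>i<n. u' i t) - B (A t) (x t)) \<le> e"
      using ev by (subst eventually_sequentially_Suc[symmetric])
    then show "\<forall>\<^sub>F n in sequentially. \<forall>t\<in>{0..\<tau>}. \<forall>h.
        norm ((\<Sum>i<n. h *\<^sub>R u' i t) - h *\<^sub>R B (A t) (x t)) \<le> e * norm h"
    proof eventually_elim
      case (elim n)
      then show ?case
        by (simp add: scaleR_sum_right[symmetric] scaleR_diff_right[symmetric] mult.commute[of e] mult_left_mono)
    qed
  next
    show "0 \<in> {0..\<tau>}" using \<open>0 \<le> \<tau>\<close> by simp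
    show "(\<lambda>n. u n 0) sums x 0" using \<open>0 \<le> \<tau>\<close> by (intro sums) simp
  qed (use du in auto)
  then obtain g where g: "\<And>t. t \<in> {0..\<tau>} \<Longrightarrow> (\<lambda>n. u n t) sums g t"
    "\<And>t. t \<in> {0..\<tau>} \<Longrightarrow> (g has_derivative (\<lambda>h. h *\<^sub>R B (A t) (x t))) (at t within {0..\<tau>})"
    by blast
  have gx: "g t = x t" if "t \<in> {0..\<tau>}" for t
    using g(1)[OF that] sums[OF that] by (rule sums_unique2)
  have "u n 0 = (if n = 0 then x0 else 0)" for n
    by (cases n) (simp_all add: u0 uS)
  then have "(\<lambda>n. u n 0) sums x0" using sums_single[of 0 "\<lambda>_. x0"] by simp
  then have "g 0 = x0"
    using g(1)[of 0] \<open>0 \<le> \<tau>\<close> sums_unique2 by fastforce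
  then show ?thesis
    using g(2) gx by (intro exI[of _ g]) (simp add: has_vector_derivative_def)
qed

text \<open>The angle between \<open>m 0\<close> and \<open>m t\<close> grows no faster than the
  speed of \<open>m\<close>: the velocity is tangent to the sphere, so it sees only the component of
  \<open>m 0\<close> orthogonal to \<open>m t\<close>, and the length of that component cancels the
  denominator in the derivative of \<open>arccos\<close>.\<close>

lemma unit_sphere_arc_bound:
  fixes m m' :: "real \<Rightarrow> 'a::real_inner"
  assumes "0 \<le> \<tau>"
    and m: "\<And>t. t \<in> {0..\<tau>} \<Longrightarrow> (m has_vector_derivative m' t) (at t within {0..\<tau>})"
    and unit: "\<And>t. t \<in> {0..\<tau>} \<Longrightarrow> norm (m t) = 1"
    and cont: "continuous_on {0..\<tau>} (\<lambda>t. norm (m' t))"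
  shows "arccos (m 0 \<bullet> m \<tau>) \<le> integral {0..\<tau>} (\<lambda>t. norm (m' t))"
proof -
  define f where "f t = m 0 \<bullet> m t" for t
  define I where "I t = integral {0..t} (\<lambda>t. norm (m' t))" for t
  have I: "(I has_real_derivative norm (m' t)) (at t within {0..\<tau>})" if "t \<in> {0..\<tau>}" for t
    using integral_has_vector_derivative[OF cont that] unfolding I_def
    by (simp add: has_real_derivative_iff_has_vector_derivative)
  have f: "(f has_real_derivative m 0 \<bullet> m' t) (at t within {0..\<tau>})" if "t \<in> {0..\<tau>}" for t
    unfolding f_def has_real_derivative_iff_has_vector_derivative
    using bounded_linear.has_vector_derivative[OF bounded_linear_inner_right m[OF that]] .
  have f_le: "\<bar>f t\<bar> \<le> 1" if "t \<in> {0..\<tau>}" for t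
    using Cauchy_Schwarz_ineq2[of "m 0" "m t"] unit[of 0] unit[OF that] \<open>0 \<le> \<tau>\<close>
    by (simp add: f_def)
  \<comment> \<open>Differentiate the constant \<open>m s \<bullet> m s\<close>; at interior points
    the derivative is two-sided and hence unique.\<close>
  have orth: "m t \<bullet> m' t = 0" if "t \<in> {0<..<\<tau>}" for t
  proof -
    have t: "t \<in> {0..\<tau>}" using that by auto
    have "((\<lambda>s. m s \<bullet> m s) has_vector_derivative m t \<bullet> m' t + m' t \<bullet> m t) (at t within {0..\<tau>})"
      by (rule bounded_bilinear.has_vector_derivative[OF bounded_bilinear_inner m[OF t] m[OF t]])
    moreover have "((\<lambda>s. m s \<bullet> m s) has_vector_derivative 0) (at t within {0..\<tau>})"
      using unit by (intro has_vector_derivative_transform[OF t _ has_vector_derivative_const[of 1]])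
        (simp add: dot_square_norm)
    ultimately have "m t \<bullet> m' t + m' t \<bullet> m t = 0"
      using that by (intro vector_derivative_unique_at) (simp_all add: at_within_Icc_at)
    then show ?thesis by (simp add: inner_commute)
  qed
  have slope: "(m 0 \<bullet> m' t)\<^sup>2 \<le> (1 - (f t)\<^sup>2) * (norm (m' t))\<^sup>2" if "t \<in> {0<..<\<tau>}" for t
  proof -
    \<comment> \<open>The component of \<open>m 0\<close> orthogonal to \<open>m t\<close>;
      Cauchy-Schwarz is applied to it and the velocity.\<close>
    define w where "w = m 0 - f t *\<^sub>R m t"
    have mm: "m t \<bullet> m t = 1" "m 0 \<bullet> m 0 = 1"
      using unit[of t] unit[of 0] that by (auto simp: dot_square_norm)
    have "w \<bullet> w = 1 - (f t)\<^sup>2"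
      by (simp add: w_def inner_diff_left inner_diff_right mm inner_commute f_def power2_eq_square)
    moreover have "m 0 \<bullet> m' t = w \<bullet> m' t"
      using orth[OF that] by (simp add: w_def inner_diff_left)
    ultimately show ?thesis
      using Cauchy_Schwarz_ineq[of w "m' t"] by (simp add: power2_norm_eq_inner)
  qed
  \<comment> \<open>The factor \<open>c < 1\<close> keeps the argument of \<open>arccos\<close> away from its singularities.\<close>
  have scaled: "arccos (c * f \<tau>) - arccos c \<le> I \<tau>" if c: "0 \<le> c" "c < 1" for c
  proof -
    have cf: "\<bar>c * f t\<bar> < 1" if "t \<in> {0..\<tau>}" for t
    proof -
      have "\<bar>c * f t\<bar> \<le> c * 1"
        unfolding abs_mult using f_le[OF that] c by (intro mult_mono) auto
      then show ?thesis using c by simp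
    qed
    \<comment> \<open>Monotonicity of \<open>h\<close> is the claim for the scaled angle, because
      \<open>I 0 = 0\<close> and \<open>f 0 = 1\<close>.\<close>
    define h where "h t = I t - arccos (c * f t)" for t
    have "h 0 \<le> h \<tau>"
    proof (rule DERIV_nonneg_imp_increasing_open[OF \<open>0 \<le> \<tau>\<close>])
      show "continuous_on {0..\<tau>} h"
        unfolding h_def
      proof (intro continuous_intros ballI)
        show "continuous_on {0..\<tau>} I" "continuous_on {0..\<tau>} f"
          using DERIV_continuous[OF I] DERIV_continuous[OF f] continuous_on_eq_continuous_within by blast+
        fix t assume "t \<in> {0..\<tau>}"
        then show "-1 \<le> c * f t \<and> c * f t \<le> 1" using cf[of t] by auto
      qed
    next
      fix t assume t: "0 < t" "t < \<tau>"
      then have t': "t \<in> {0..\<tau>}" and at: "at t within {0..\<tau>} = at t"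
        by (auto intro: at_within_Icc_at)
      define s where "s = sqrt (1 - (c * f t)\<^sup>2)"
      have s2: "1 - (c * f t)\<^sup>2 > 0"
        using cf[OF t'] by (simp add: abs_square_less_1)
      then have "s > 0" by (simp add: s_def)
      have "(h has_real_derivative norm (m' t) - inverse (- s) * (c * (m 0 \<bullet> m' t))) (at t)"
        unfolding h_def s_def using cf[OF t']
        by (intro DERIV_diff DERIV_chain2[OF DERIV_arccos] DERIV_cmult I[OF t', unfolded at] f[OF t', unfolded at]) auto
      moreover have "0 \<le> norm (m' t) - inverse (- s) * (c * (m 0 \<bullet> m' t))"
      proof -
        have "c\<^sup>2 \<le> 1" using c by (simp add: power_le_one)
        have "(c * (m 0 \<bullet> m' t))\<^sup>2 \<le> c\<^sup>2 * ((1 - (f t)\<^sup>2) * (norm (m' t))\<^sup>2)"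
          unfolding power_mult_distrib using slope[of t] t by (intro mult_left_mono) auto
        also have "\<dots> = (c\<^sup>2 - (c * f t)\<^sup>2) * (norm (m' t))\<^sup>2"
          by (simp add: power_mult_distrib algebra_simps)
        also have "\<dots> \<le> s\<^sup>2 * (norm (m' t))\<^sup>2"
          using s2 \<open>c\<^sup>2 \<le> 1\<close> by (intro mult_right_mono) (simp_all add: s_def)
        also have "\<dots> = (s * norm (m' t))\<^sup>2" by (simp add: power_mult_distrib)
        finally have "\<bar>c * (m 0 \<bullet> m' t)\<bar> \<le> s * norm (m' t)"
          using \<open>s > 0\<close> by (simp add: abs_le_square_iff[symmetric] abs_mult)
        then have "- (c * (m 0 \<bullet> m' t)) \<le> s * norm (m' t)" by simp
        then show ?thesis using \<open>s > 0\<close> by (simp add: field_simps)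
      qed
      ultimately show "\<exists>y. (h has_real_derivative y) (at t) \<and> 0 \<le> y" by blast
    qed
    moreover have "f 0 = 1" using unit[of 0] \<open>0 \<le> \<tau>\<close> by (simp add: f_def dot_square_norm)
    ultimately show ?thesis by (simp add: h_def I_def)
  qed
  \<comment> \<open>Continuity of \<open>arccos\<close> on the closed interval lets the scaled bound
    pass to the limit \<open>c = 1\<close>, where \<open>arccos c\<close> vanishes.\<close>
  define F where "F c = I \<tau> - (arccos (c * f \<tau>) - arccos c)" for c
  have f1: "\<bar>f \<tau>\<bar> \<le> 1" using \<open>0 \<le> \<tau>\<close> by (intro f_le) simp
  have "continuous_on {0..1} F"
    unfolding F_def
  proof (intro continuous_intros ballI)
    fix c :: real assume c: "c \<in> {0..1}"
    have "\<bar>c * f \<tau>\<bar> \<le> 1 * 1" unfolding abs_mult using c f1 by (intro mult_mono) auto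
    then show "-1 \<le> c * f \<tau> \<and> c * f \<tau> \<le> 1" by auto
  qed auto
  then have "(F \<longlongrightarrow> F 1) (at_left 1)"
    by (rule continuous_on_Icc_at_leftD) simp
  moreover have "\<forall>\<^sub>F c in at_left 1. 0 \<le> F c"
    using eventually_at_left_field[of "\<lambda>c. 0 \<le> F c" "1::real"] scaled
    by (auto simp: F_def intro!: exI[of _ 0])
  ultimately have "0 \<le> F 1"
    by (intro tendsto_lowerbound) auto
  then show ?thesis by (simp add: F_def f_def I_def)
qed

section \<open>The non-hermitian dynamics\<close>

lemma cscale_diff: "cscale c (A - B) = cscale c A - cscale c B"
  by (simp add: cscale_def vec_eq_iff algebra_simps)

lemma cscale_cscale: "cscale c (cscale d A) = cscale (c * d) A"
  by (simp add: cscale_def vec_eq_iff)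

lemma cscale_uminus: "cscale (- c) A = - cscale c A"
  by (simp add: cscale_def vec_eq_iff)

lemma cscale_of_real: "cscale (of_real r) A = r *\<^sub>R A"
  by (simp add: cscale_def vec_eq_iff scaleR_conv_of_real[where 'a=complex])

lemma cscale_mult_left: "cscale c A ** B = cscale c (A ** B)"
  by (simp add: cscale_def vec_eq_iff matrix_matrix_mult_def sum_distrib_left mult.assoc)

lemma cscale_mult_right: "A ** cscale c B = cscale c (A ** B)"
  by (simp add: cscale_def vec_eq_iff matrix_matrix_mult_def sum_distrib_left mult_ac)

lemma dagger_cscale: "dagger (cscale c A) = cscale (cnj c) (dagger A)"
  by (simp add: cscale_def vec_eq_iff)

lemma bounded_linear_cscale: "bounded_linear (cscale c)"
  unfolding linear_conv_bounded_linear[symmetric]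
  by (intro linearI) (simp_all add: cscale_def vec_eq_iff algebra_simps)

lemmas has_vector_derivative_matrix_mult =
    bounded_bilinear.has_vector_derivative[OF bounded_bilinear_matrix_mult]
  and continuous_on_matrix_mult = bounded_bilinear.continuous_on[OF bounded_bilinear_matrix_mult]
  and has_vector_derivative_dagger =
    bounded_linear.has_vector_derivative[OF bounded_linear_dagger]

lemma has_vector_derivative_zero_imp_eq:
  fixes f :: "real \<Rightarrow> 'a::real_normed_vector"
  assumes "\<And>t. t \<in> {0..\<tau>} \<Longrightarrow> (f has_vector_derivative 0) (at t within {0..\<tau>})" "t \<in> {0..\<tau>}"
  shows "f t = f 0"
proof -
  have "\<exists>c. \<forall>t\<in>{0..\<tau>}. f t = c"
    using assms(1) by (intro has_derivative_zero_constant) (simp_all add: has_vector_derivative_def)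
  moreover have "0 \<in> {0..\<tau>}" using assms(2) by simp
  ultimately show ?thesis using assms(2) by metis
qed

text \<open>The generator and its adjoint cancel in the derivative of
  \<open>dagger (W t) ** W t\<close>, so this product stays the identity; for square matrices a left
  inverse is two-sided.\<close>

lemma skew_hermitian_flow_unitary:
  assumes W: "\<And>t. t \<in> {0..\<tau>} \<Longrightarrow> (W has_vector_derivative A t ** W t) (at t within {0..\<tau>})"
    and "W 0 = mat 1" and skew: "\<And>t. t \<in> {0..\<tau>} \<Longrightarrow> dagger (A t) = - A t"
    and t: "t \<in> {0..\<tau>}"
  shows "unitary (W t)"
proof -
  have "((\<lambda>t. dagger (W t) ** W t) has_vector_derivative 0) (at s within {0..\<tau>})"
    if s: "s \<in> {0..\<tau>}" for s
    using has_vector_derivative_matrix_mult[OF has_vector_derivative_dagger[OF W[OF s]] W[OF s]]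
    by (simp add: dagger_mult skew[OF s] matrix_mul_assoc
        bounded_bilinear.minus_left[OF bounded_bilinear_matrix_mult]
        bounded_bilinear.minus_right[OF bounded_bilinear_matrix_mult])
  then have "dagger (W t) ** W t = dagger (W 0) ** W 0"
    using t by (rule has_vector_derivative_zero_imp_eq)
  then show ?thesis
    using \<open>W 0 = mat 1\<close> by (simp add: unitary_def matrix_left_right_inverse)
qed

text \<open>The inverse of the propagator \<open>K\<close> is the adjoint of the propagator generated by
  \<open>- L\<^sup>\<dagger>\<close>, and it transports \<open>\<rho>(t)\<close> back to a constant.\<close>

lemma propagator_conjugation:
  fixes L K \<rho> :: "real \<Rightarrow> complex^'n^'n"
  assumes "0 \<le> \<tau>" and L: "continuous_on {0..\<tau>} L"
    and K: "\<And>t. t \<in> {0..\<tau>} \<Longrightarrow> (K has_vector_derivative L t ** K t) (at t within {0..\<tau>})"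
    and K0: "K 0 = mat 1"
    and \<rho>: "\<And>t. t \<in> {0..\<tau>} \<Longrightarrow>
      (\<rho> has_vector_derivative L t ** \<rho> t + \<rho> t ** dagger (L t)) (at t within {0..\<tau>})"
    and t: "t \<in> {0..\<tau>}"
  shows "invertible (K t)" and "\<rho> t = K t ** \<rho> 0 ** dagger (K t)"
proof -
  have "continuous_on {0..\<tau>} (\<lambda>t. - dagger (L t))"
    by (intro continuous_on_minus bounded_linear.continuous_on[OF bounded_linear_dagger] L)
  from linear_ode_solution_exists[OF bounded_bilinear_matrix_mult \<open>0 \<le> \<tau>\<close> this, of "mat 1"]
  obtain M where M0: "M 0 = mat 1" and M: "\<And>t. t \<in> {0..\<tau>} \<Longrightarrow>
      (M has_vector_derivative - dagger (L t) ** M t) (at t within {0..\<tau>})"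
    by blast
  define N where "N t = dagger (M t)" for t
  have N0: "N 0 = mat 1" by (simp add: N_def M0)
  note minus = bounded_bilinear.minus_left[OF bounded_bilinear_matrix_mult]
    bounded_bilinear.minus_right[OF bounded_bilinear_matrix_mult]

  have N: "(N has_vector_derivative - (N t ** L t)) (at t within {0..\<tau>})" if "t \<in> {0..\<tau>}" for t
    unfolding N_def using has_vector_derivative_dagger[OF M[OF that]]
    by (simp add: dagger_mult minus dagger_uminus)
  have "((\<lambda>t. N t ** K t) has_vector_derivative 0) (at s within {0..\<tau>})" if s: "s \<in> {0..\<tau>}" for s
    using has_vector_derivative_matrix_mult[OF N[OF s] K[OF s]]
    by (simp add: minus matrix_mul_assoc)
  then have "N t ** K t = N 0 ** K 0"
    using t by (rule has_vector_derivative_zero_imp_eq)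
  then have NK: "N t ** K t = mat 1" by (simp add: N0 K0)
  then have KN: "K t ** N t = mat 1" by (simp add: matrix_left_right_inverse)
  then show "invertible (K t)" using NK unfolding invertible_def by blast
  have "((\<lambda>t. N t ** \<rho> t ** dagger (N t)) has_vector_derivative 0) (at s within {0..\<tau>})"
    if s: "s \<in> {0..\<tau>}" for s
    using has_vector_derivative_matrix_mult[OF has_vector_derivative_matrix_mult[OF N[OF s] \<rho>[OF s]]
        has_vector_derivative_dagger[OF N[OF s]]]
    by (simp add: minus dagger_uminus dagger_mult matrix_mul_assoc matrix_add_left matrix_add_right)
  then have "N t ** \<rho> t ** dagger (N t) = N 0 ** \<rho> 0 ** dagger (N 0)"
    using t by (rule has_vector_derivative_zero_imp_eq)
  then have "\<rho> 0 = N t ** \<rho> t ** dagger (N t)" by (simp add: N0)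
  then have "K t ** \<rho> 0 ** dagger (K t) = (K t ** N t) ** \<rho> t ** dagger (K t ** N t)"
    by (simp add: dagger_mult matrix_mul_assoc)
  then show "\<rho> t = K t ** \<rho> 0 ** dagger (K t)" by (simp add: KN)
qed

text \<open>Normalization removes the radial part of the velocity and divides the rest by the
  length.\<close>

lemma has_vector_derivative_sgn:
  fixes Q :: "real \<Rightarrow> 'a::real_inner"
  assumes Q: "(Q has_vector_derivative Q') (at t within S)" and "Q t \<noteq> 0"
  shows "((\<lambda>t. sgn (Q t)) has_vector_derivative
    (Q' - (sgn (Q t) \<bullet> Q') *\<^sub>R sgn (Q t)) /\<^sub>R norm (Q t)) (at t within S)"
proof -
  have "((\<lambda>t. Q t \<bullet> Q t) has_real_derivative 2 * (Q t \<bullet> Q')) (at t within S)"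
    using bounded_bilinear.has_vector_derivative[OF bounded_bilinear_inner Q Q]
    by (simp add: has_real_derivative_iff_has_vector_derivative inner_commute)
  moreover have "(sqrt has_real_derivative inverse (norm (Q t)) / 2) (at (Q t \<bullet> Q t))"
    using DERIV_real_sqrt[of "Q t \<bullet> Q t"] \<open>Q t \<noteq> 0\<close> by (simp add: norm_eq_sqrt_inner)
  ultimately have "((\<lambda>t. norm (Q t)) has_real_derivative
      inverse (norm (Q t)) / 2 * (2 * (Q t \<bullet> Q'))) (at t within S)"
    unfolding norm_eq_sqrt_inner[of "Q _"] by (rule DERIV_chain2[rotated])
  then have "((\<lambda>t. inverse (norm (Q t))) has_real_derivative
      - (inverse (norm (Q t)) * (inverse (norm (Q t)) / 2 * (2 * (Q t \<bullet> Q'))) * inverse (norm (Q t))))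
      (at t within S)"
    using \<open>Q t \<noteq> 0\<close> by (intro DERIV_inverse') simp_all
  also have "- (inverse (norm (Q t)) * (inverse (norm (Q t)) / 2 * (2 * (Q t \<bullet> Q'))) * inverse (norm (Q t)))
      = - (Q t \<bullet> Q') / norm (Q t) ^ 3"
    by (simp add: power3_eq_cube field_simps)
  finally have "((\<lambda>t. inverse (norm (Q t))) has_vector_derivative
      - (Q t \<bullet> Q') / norm (Q t) ^ 3) (at t within S)"
    by (simp only: has_real_derivative_iff_has_vector_derivative)
  from bounded_bilinear.has_vector_derivative[OF bounded_bilinear_scaleR this Q]
  have "((\<lambda>t. sgn (Q t)) has_vector_derivative
      Q' /\<^sub>R norm (Q t) + (- (Q t \<bullet> Q') / norm (Q t) ^ 3) *\<^sub>R Q t) (at t within S)"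
    by (simp add: sgn_div_norm)
  also have "Q' /\<^sub>R norm (Q t) + (- (Q t \<bullet> Q') / norm (Q t) ^ 3) *\<^sub>R Q t
      = (Q' - (sgn (Q t) \<bullet> Q') *\<^sub>R sgn (Q t)) /\<^sub>R norm (Q t)"
    by (simp add: sgn_div_norm scaleR_diff_right power3_eq_cube divide_inverse mult_ac)
  finally show ?thesis .
qed

text \<open>Expectations in the state \<open>Z ** dagger Z\<close> are overlaps
  \<open>Z \<bullet> (A ** Z)\<close>. The variance is then the squared length of
  \<open>X ** Z\<close> after its component along \<open>Z\<close> is removed.\<close>

lemma std_deviation_purification:
  fixes X Z :: "complex^'n^'n"
  assumes "hermitian X" "norm Z = 1"
  shows "std_deviation X (Z ** dagger Z) = norm (X ** Z - (Z \<bullet> (X ** Z)) *\<^sub>R Z)"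
proof -
  have E: "expectation A (Z ** dagger Z) = Z \<bullet> (A ** Z)" for A :: "complex^'n^'n"
    by (simp add: expectation_def matrix_mul_assoc Re_trace_mult_dagger)
  have "Z \<bullet> (X ** X ** Z) = (X ** Z) \<bullet> (X ** Z)"
    using assms(1) by (simp add: inner_matrix_adjoint_left hermitian_def matrix_mul_assoc)
  moreover have "Z \<bullet> Z = 1" using assms(2) by (simp add: dot_square_norm)
  ultimately have "expectation (X ** X) (Z ** dagger Z) - (expectation X (Z ** dagger Z))\<^sup>2
      = (norm (X ** Z - (Z \<bullet> (X ** Z)) *\<^sub>R Z))\<^sup>2"
    unfolding power2_norm_eq_inner
    by (simp add: E inner_diff_left inner_diff_right inner_commute power2_eq_square)
  then show ?thesis by (simp add: std_deviation_def)
qed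

text \<open>The trace of \<open>Y ** dagger Y\<close> is the squared norm of \<open>Y\<close>, so
  normalizing the state amounts to normalizing its purification.\<close>

lemma normalized_purification: "normalized (Y ** dagger Y) = sgn Y ** dagger (sgn Y)"
proof -
  have "normalized (Y ** dagger Y) = (1 / (norm Y)\<^sup>2) *\<^sub>R (Y ** dagger Y)"
    unfolding normalized_def trace_mult_dagger_self cscale_of_real[symmetric] by simp
  then show ?thesis
    by (simp add: sgn_div_norm dagger_scaleR matrix_scaleR_left matrix_scaleR_right
        power2_eq_square divide_inverse)
qed

text \<open>Outside \<open>[-1, 1]\<close> the function \<open>arccos\<close> takes one unspecified value.\<close>

lemma arccos_bounded_below: "\<exists>b. \<forall>y. b \<le> arccos y"
proof -
  have "min 0 (THE x::real. False) \<le> arccos y" for y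
  proof (cases "\<bar>y\<bar> \<le> 1")
    case True
    then show ?thesis using arccos_lbound[of y] by (intro min.coboundedI1) (simp add: abs_le_iff)
  next
    case False
    then have "(\<lambda>x. 0 \<le> x \<and> x \<le> pi \<and> cos x = y) = (\<lambda>x. False)"
      using abs_cos_le_one by (intro ext) auto
    then show ?thesis unfolding arccos_def by (simp only: min.cobounded2)
  qed
  then show ?thesis by blast
qed

text \<open>An infimum lies below each member only if the set is bounded below. Arbitrary
  \<open>\<rho>\<close> and \<open>\<sigma>\<close> may push \<open>arccos\<close> outside its
  proper domain, hence the bound covering its unspecified value.\<close>

lemma bures_class_dist_le:
  assumes "unitary U"
  shows "bures_class_dist \<rho> \<sigma> \<le> bures_angle (U ** \<rho> ** dagger U) \<sigma>"
proof -
  obtain b where "\<And>y. b \<le> arccos y" using arccos_bounded_below by blast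
  then have "bdd_below ((\<lambda>U. bures_angle (U ** \<rho> ** dagger U) \<sigma>) ` {U. unitary U})"
    by (auto simp: bures_angle_def intro!: bdd_belowI)
  then show ?thesis
    unfolding bures_class_dist_def using assms by (intro cINF_lower) auto
qed

theorem mainTheorem8:
  fixes H \<Gamma> \<rho> :: "real \<Rightarrow> complex^'n^'n" and \<tau> :: real
  assumes "\<tau> > 0"
    and "\<And>t. t \<in> {0..\<tau>} \<Longrightarrow> hermitian (H t)"
    and "\<And>t. t \<in> {0..\<tau>} \<Longrightarrow> hermitian (\<Gamma> t)"
    and "continuous_on {0..\<tau>} H"
    and "continuous_on {0..\<tau>} \<Gamma>"
    and "density_operator (\<rho> 0)"
    and "\<And>t. t \<in> {0..\<tau>} \<Longrightarrow>
           (\<rho> has_vector_derivative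
              cscale (- \<i>) (nh_generator (H t) (\<Gamma> t) ** \<rho> t
                             - \<rho> t ** dagger (nh_generator (H t) (\<Gamma> t))))
           (at t within {0..\<tau>})"
    and "integral {0..\<tau>} (\<lambda>t. std_deviation (\<Gamma> t) (normalized (\<rho> t))) \<le> pi / 2"
    and "time_average \<tau> (\<lambda>t. std_deviation (\<Gamma> t) (normalized (\<rho> t))) \<noteq> 0"
  shows "\<tau> \<ge> bures_class_dist (normalized (\<rho> 0)) (normalized (\<rho> \<tau>))
              / time_average \<tau> (\<lambda>t. std_deviation (\<Gamma> t) (normalized (\<rho> t)))"
proof -
  have \<tau>: "0 \<le> \<tau>" "0 \<in> {0..\<tau>}" "\<tau> \<in> {0..\<tau>}" using assms(1) by simp_all
  \<comment> \<open>\<open>A\<close> generates the unitary flow \<open>W\<close> of \<open>H\<close>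
    alone; \<open>L\<close> is the full generator, acting on \<open>\<rho>\<close> from the left,
    with its adjoint on the right.\<close>
  define A where "A t = cscale (- \<i>) (H t)" for t
  define L where "L t = A t - \<Gamma> t" for t
  have A: "continuous_on {0..\<tau>} A"
    unfolding A_def by (intro bounded_linear.continuous_on[OF bounded_linear_cscale] assms)
  have L: "continuous_on {0..\<tau>} L"
    unfolding L_def by (intro continuous_on_diff A assms)
  have skew: "dagger (A t) = - A t" if "t \<in> {0..\<tau>}" for t
    using assms(2)[OF that] by (simp add: A_def dagger_cscale hermitian_def cscale_uminus dagger_uminus)
  have L_eq: "L t = cscale (- \<i>) (nh_generator (H t) (\<Gamma> t))" for t
    using cscale_of_real[of 1 "\<Gamma> t"]
    by (simp add: L_def A_def nh_generator_def cscale_diff cscale_cscale)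
  have \<rho>: "(\<rho> has_vector_derivative L t ** \<rho> t + \<rho> t ** dagger (L t)) (at t within {0..\<tau>})"
    if "t \<in> {0..\<tau>}" for t
    using assms(7)[OF that]
    by (simp add: L_eq dagger_cscale cscale_mult_left cscale_mult_right cscale_diff cscale_uminus
        dagger_uminus bounded_bilinear.minus_left[OF bounded_bilinear_matrix_mult])
  obtain K where K0: "K 0 = mat 1" and K: "\<And>t. t \<in> {0..\<tau>} \<Longrightarrow>
      (K has_vector_derivative L t ** K t) (at t within {0..\<tau>})"
    using linear_ode_solution_exists[OF bounded_bilinear_matrix_mult \<tau>(1) L, of "mat 1"] by blast
  obtain W where W0: "W 0 = mat 1" and W: "\<And>t. t \<in> {0..\<tau>} \<Longrightarrow>
      (W has_vector_derivative A t ** W t) (at t within {0..\<tau>})"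
    using linear_ode_solution_exists[OF bounded_bilinear_matrix_mult \<tau>(1) A, of "mat 1"] by blast
  have W_unitary: "unitary (W t)" if "t \<in> {0..\<tau>}" for t
    using skew_hermitian_flow_unitary[OF W W0 skew that] .
  obtain S where S: "positive_semidefinite S" and \<rho>0: "\<rho> 0 = S ** S"
    using assms(6) exists_positive_semidefinite_sqrt unfolding density_operator_def by metis
  have S_dagger: "dagger S = S" using S by (simp add: positive_semidefinite_iff hermitian_def)
  have "complex_of_real ((norm S)\<^sup>2) = of_real 1"
    using trace_mult_dagger_self[of S] assms(6) by (simp add: S_dagger density_operator_def \<rho>0)
  then have "(norm S)\<^sup>2 = 1\<^sup>2" by (simp only: of_real_eq_iff power_one)
  then have S_norm: "norm S = 1" by (rule power2_eq_imp_eq) simp_all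

  \<comment> \<open>\<open>Y\<close> purifies \<open>\<rho>\<close>, \<open>Z\<close> purifies the
    normalized state, and \<open>Q\<close> is \<open>Y\<close> seen in the frame moving with
    \<open>W\<close>.\<close>
  define Y where "Y t = K t ** S" for t
  define Z where "Z t = sgn (Y t)" for t
  define Q where "Q t = dagger (W t) ** Y t" for t
  have Y_nonzero: "Y t \<noteq> 0" if t: "t \<in> {0..\<tau>}" for t
  proof
    assume "Y t = 0"
    moreover obtain N where "N ** K t = mat 1"
      using propagator_conjugation(1)[OF \<tau>(1) L K K0 \<rho> t] unfolding invertible_def by blast
    ultimately have "S = 0"
      using matrix_mul_assoc[of N "K t" S]
      by (simp add: Y_def bounded_bilinear.zero_right[OF bounded_bilinear_matrix_mult])
    then show False using S_norm by simp
  qed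
  have normalized_\<rho>: "normalized (\<rho> t) = Z t ** dagger (Z t)" if "t \<in> {0..\<tau>}" for t
  proof -
    have "\<rho> t = Y t ** dagger (Y t)"
      using propagator_conjugation(2)[OF \<tau>(1) L K K0 \<rho> that]
      by (simp add: Y_def \<rho>0 dagger_mult S_dagger matrix_mul_assoc)
    then show ?thesis by (simp add: normalized_purification Z_def)
  qed
  have Z_norm: "norm (Z t) = 1" if "t \<in> {0..\<tau>}" for t
    using Y_nonzero[OF that] by (simp add: Z_def norm_sgn)
  have Y: "(Y has_vector_derivative L t ** Y t) (at t within {0..\<tau>})" if "t \<in> {0..\<tau>}" for t
    unfolding Y_def
    using has_vector_derivative_matrix_mult[OF K[OF that] has_vector_derivative_const[of S]]
    by (simp add: matrix_mul_assoc bounded_bilinear.zero_right[OF bounded_bilinear_matrix_mult])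
  \<comment> \<open>The \<open>H\<close> contributions from \<open>dagger (W t)\<close> and from
    \<open>Y t\<close> cancel, leaving only \<open>\<Gamma>\<close>.\<close>
  have Q: "(Q has_vector_derivative - (dagger (W t) ** (\<Gamma> t ** Y t))) (at t within {0..\<tau>})"
    if "t \<in> {0..\<tau>}" for t
    unfolding Q_def
    using has_vector_derivative_matrix_mult[OF has_vector_derivative_dagger[OF W[OF that]] Y[OF that]]
    by (simp add: dagger_mult skew[OF that] L_def matrix_mul_assoc matrix_diff_left matrix_diff_right
        bounded_bilinear.minus_left[OF bounded_bilinear_matrix_mult]
        bounded_bilinear.minus_right[OF bounded_bilinear_matrix_mult])
  have Q_norm: "norm (Q t) = norm (Y t)" if "t \<in> {0..\<tau>}" for t
    unfolding Q_def by (rule norm_unitary_mult[OF unitary_dagger[OF W_unitary[OF that]]])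
  have Q_sgn: "sgn (Q t) = dagger (W t) ** Z t" if "t \<in> {0..\<tau>}" for t
    by (simp add: sgn_div_norm Q_norm[OF that] Z_def) (simp add: Q_def matrix_scaleR_right)
  \<comment> \<open>\<open>\<gamma>\<close> is the expectation of \<open>\<Gamma>\<close> and
    \<open>D\<close> the centred operator applied to \<open>Z\<close>; the norm of \<open>D\<close>
    is the standard deviation.\<close>
  define \<gamma> where "\<gamma> t = Z t \<bullet> (\<Gamma> t ** Z t)" for t
  define D where "D t = \<Gamma> t ** Z t - \<gamma> t *\<^sub>R Z t" for t
  have sgn_Q: "((\<lambda>t. sgn (Q t)) has_vector_derivative - (dagger (W t) ** D t)) (at t within {0..\<tau>})"
    if t: "t \<in> {0..\<tau>}" for t
  proof -
    let ?Q' = "- (dagger (W t) ** (\<Gamma> t ** Y t))"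
    have "Q t \<noteq> 0" using Q_norm[OF t] Y_nonzero[OF t] by auto
    have Q': "?Q' /\<^sub>R norm (Y t) = - (dagger (W t) ** (\<Gamma> t ** Z t))"
      by (simp add: Z_def sgn_div_norm matrix_scaleR_right)
    have "(sgn (Q t) \<bullet> ?Q') / norm (Y t) = sgn (Q t) \<bullet> (?Q' /\<^sub>R norm (Y t))"
      by (simp add: divide_inverse mult.commute)
    also have "\<dots> = - \<gamma> t"
      unfolding Q' using W_unitary[OF t]
      by (simp add: Q_sgn[OF t] inner_matrix_adjoint_left unitaryD \<gamma>_def)
    finally have "(?Q' - (sgn (Q t) \<bullet> ?Q') *\<^sub>R sgn (Q t)) /\<^sub>R norm (Q t) =
        - (dagger (W t) ** (\<Gamma> t ** Z t)) + \<gamma> t *\<^sub>R (dagger (W t) ** Z t)"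
      unfolding Q_norm[OF t] scaleR_diff_right Q' by (simp add: Q_sgn[OF t] divide_inverse mult.commute)
    also have "\<dots> = - (dagger (W t) ** D t)"
      by (simp add: D_def matrix_diff_right matrix_scaleR_right)
    finally show ?thesis using has_vector_derivative_sgn[OF Q[OF t] \<open>Q t \<noteq> 0\<close>] by simp
  qed
  have speed: "norm (- (dagger (W t) ** D t)) = std_deviation (\<Gamma> t) (normalized (\<rho> t))"
    if "t \<in> {0..\<tau>}" for t
    using std_deviation_purification[OF assms(3) Z_norm, OF that that] W_unitary[OF that]
    by (simp add: normalized_\<rho>[OF that] D_def \<gamma>_def norm_unitary_mult unitary_dagger)
  have "continuous_on {0..\<tau>} Y" "continuous_on {0..\<tau>} W"
    using has_vector_derivative_continuous[OF Y] has_vector_derivative_continuous[OF W]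
      continuous_on_eq_continuous_within by blast+
  then have "continuous_on {0..\<tau>} (\<lambda>t. norm (- (dagger (W t) ** D t)))"
    unfolding D_def \<gamma>_def Z_def sgn_div_norm using Y_nonzero
    by (intro continuous_intros continuous_on_matrix_mult assms
        bounded_linear.continuous_on[OF bounded_linear_dagger]) auto
  moreover have "norm (sgn (Q t)) = 1" if "t \<in> {0..\<tau>}" for t
    using Q_norm[OF that] Y_nonzero[OF that] by (auto simp: norm_sgn)
  ultimately have "arccos (sgn (Q 0) \<bullet> sgn (Q \<tau>)) \<le> integral {0..\<tau>} (\<lambda>t. norm (- (dagger (W t) ** D t)))"
    by (intro unit_sphere_arc_bound sgn_Q \<tau>)
  also have "\<dots> = integral {0..\<tau>} (\<lambda>t. std_deviation (\<Gamma> t) (normalized (\<rho> t)))"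
    using speed by (rule integral_cong)
  also have "sgn (Q 0) = S"
    by (simp add: Q_def Y_def W0 K0 S_norm sgn_div_norm)
  finally have arc: "arccos (S \<bullet> sgn (Q \<tau>)) \<le> integral {0..\<tau>} (\<lambda>t. std_deviation (\<Gamma> t) (normalized (\<rho> t)))" .

  \<comment> \<open>\<open>R\<close> is the square root of the rotated initial state. The factor
    \<open>dagger U\<close> in \<open>B\<close> leaves \<open>B ** dagger B\<close> unchanged but
    turns \<open>R \<bullet> B\<close> into the overlap of the end points of the curve
    \<open>sgn (Q t)\<close>.\<close>
  define U where "U = W \<tau>"
  have U: "unitary U" unfolding U_def by (rule W_unitary[OF \<tau>(3)])
  define R where "R = U ** S ** dagger U"
  define B where "B = Z \<tau> ** dagger U"
  have R: "positive_semidefinite R" unfolding R_def by (rule positive_semidefinite_conjugate[OF S])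
  have R_norm: "norm R = 1"
    using U by (simp add: R_def norm_mult_unitary unitary_dagger norm_unitary_mult S_norm)
  have B_norm: "norm B = 1"
    using U by (simp add: B_def norm_mult_unitary unitary_dagger Z_norm \<tau>)
  have "normalized (\<rho> 0) = S ** S"
    using normalized_purification[of S] by (simp add: \<rho>0 S_dagger S_norm sgn_div_norm)
  then have RR: "U ** normalized (\<rho> 0) ** dagger U = R ** R"
    using U by (simp add: R_def matrix_mul_assoc unitaryD)
  have BB: "normalized (\<rho> \<tau>) = B ** dagger B"
    using U by (simp add: B_def normalized_\<rho> \<tau> dagger_mult matrix_mul_assoc unitaryD)
  have RB: "R \<bullet> B = S \<bullet> sgn (Q \<tau>)"
    using U Q_sgn[OF \<tau>(3)] inner_matrix_adjoint_left[of U S "Z \<tau>"]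
    by (simp add: R_def B_def inner_matrix_adjoint_right[of "U ** S"] unitaryD U_def[symmetric])
  have "bures_class_dist (normalized (\<rho> 0)) (normalized (\<rho> \<tau>))
      \<le> bures_angle (R ** R) (B ** dagger B)"
    using bures_class_dist_le[OF U] by (simp add: RR[symmetric] BB)
  \<comment> \<open>\<open>arccos\<close> is decreasing on \<open>[-1, 1]\<close>; the fidelity
    bounds place both arguments there in the right order.\<close>
  also have "\<dots> \<le> arccos (R \<bullet> B)"
    unfolding bures_angle_def
  proof (rule arccos_le_arccos)
    show "- 1 \<le> R \<bullet> B"
      using Cauchy_Schwarz_ineq2[of R B] by (simp add: R_norm B_norm abs_le_iff)
  qed (use fidelity_purification_bounds[OF R R_norm B_norm] in auto)
  also have "\<dots> \<le> integral {0..\<tau>} (\<lambda>t. std_deviation (\<Gamma> t) (normalized (\<rho> t)))"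
    unfolding RB by (rule arc)
  finally have bound: "bures_class_dist (normalized (\<rho> 0)) (normalized (\<rho> \<tau>))
      \<le> integral {0..\<tau>} (\<lambda>t. std_deviation (\<Gamma> t) (normalized (\<rho> t)))" .
  \<comment> \<open>Nonnegativity turns the nonzero time average into a positive one, so dividing by
    it preserves the inequality.\<close>
  have "0 \<le> integral {0..\<tau>} (\<lambda>t. norm (- (dagger (W t) ** D t)))"
    by (cases "(\<lambda>t. norm (- (dagger (W t) ** D t))) integrable_on {0..\<tau>}")
      (auto intro: integral_nonneg simp: not_integrable_integral)
  also have "\<dots> = integral {0..\<tau>} (\<lambda>t. std_deviation (\<Gamma> t) (normalized (\<rho> t)))"
    using speed by (rule integral_cong)
  finally show ?thesis
    using bound assms(1,9) by (simp add: time_average_def field_simps)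
qed

end
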